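(* For all integers $k \ge 0$ and $\ell \ge 3$, there exists an integer $f(k,\ell) \ge 0$ such that the tournament $A_{f(k,\ell)}$ contains a subdigraph $S \subseteq A_{f(k,\ell)}$ with $\overrightarrow{\chi}(S) > k$ and $\mathrm{girth}(S) > \ell$.
   Context: All digraphs are finite. A tournament is a digraph with exactly one arc between every pair of distinct vertices (and no loops). Subdigraphs are not necessarily induced. For disjoint vertex sets (or vertices, or vertex-disjoint subdigraphs) $X, Y$, write $X \Rightarrow Y$ (equivalently $Y \Leftarrow X$) if $xy$ is an arc for all $x \in X$ and $y \in Y$. The tournaments $A_n$ are defined recursively: $A_0$ is the one-vertex tournament, and for $n \ge 1$, $A_n$ is the tournament made from $n$ vertex-disjoint copies $T_1, \dots, T_n$ of $A_{n-1}$ and $n+1$ additional vertices $v_0, \dots, v_n$ such that: $v_i \Leftarrow v_j$ (that is, $v_jv_i$ is an arc) and $v_i \Rightarrow T_j$ for all $0 \le i < j \le n$; $T_i \Rightarrow v_j$ for all $1 \le i \le j \le n$; and $T_i \Rightarrow T_j$ for all $1 \le i < j \le n$. The dichromatic number $\overrightarrow{\chi}(D)$ of a digraph $D$ is the least integer $k \ge 0$ such that the vertices of $D$ can be partitioned into $k$ sets each inducing an acyclic subdigraph (no directed cycle). The girth $\mathrm{girth}(D)$ of a digraph $D$ is the minimum size of a cycle in its underlying undirected graph ($+\infty$ if there is none). *)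

theory Defs
  imports
    "Graph_Theory.Digraph_Component"
    "HOL-Library.Disjoint_Sets"
    "HOL-Library.Extended_Nat"
begin

definition tournament :: "'a pair_pre_digraph \<Rightarrow> bool" where
  "tournament G \<longleftrightarrow> pair_digraph G \<and>
    (\<forall>u \<in> pverts G. \<forall>v \<in> pverts G. u \<noteq> v \<longrightarrow> ((u, v) \<in> parcs G) \<noteq> ((v, u) \<in> parcs G))"

text \<open>
  Vertex names for the recursive construction of the tournaments below:
  \<open>New i\<close> is the additional vertex \<open>v\<^sub>i\<close>, and \<open>Copy j x\<close> is the vertex corresponding to
  \<open>x\<close> in the \<open>j\<close>-th copy \<open>T\<^sub>j\<close> of the preceding tournament.
\<close>

datatype vtx = New nat | Copy nat vtx

fun A :: "nat \<Rightarrow> vtx pair_pre_digraph" where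
  "A 0 = \<lparr> pverts = {New 0}, parcs = {} \<rparr>"
| "A (Suc m) =
    (let n = Suc m; V = pverts (A m); E = parcs (A m) in
     \<lparr> pverts = {New i | i. i \<le> n} \<union> {Copy j x | j x. 1 \<le> j \<and> j \<le> n \<and> x \<in> V},
       parcs = {(New j, New i) | i j. i < j \<and> j \<le> n}
         \<union> {(New i, Copy j x) | i j x. i < j \<and> j \<le> n \<and> x \<in> V}
         \<union> {(Copy i x, New j) | i j x. 1 \<le> i \<and> i \<le> j \<and> j \<le> n \<and> x \<in> V}
         \<union> {(Copy i x, Copy j y) | i j x y. 1 \<le> i \<and> i < j \<and> j \<le> n \<and> x \<in> V \<and> y \<in> V}
         \<union> {(Copy j x, Copy j y) | j x y. 1 \<le> j \<and> j \<le> n \<and> (x, y) \<in> E} \<rparr>)"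

lemma A_arcs_in_verts:
  assumes "parcs (A m) \<subseteq> pverts (A m) \<times> pverts (A m)"
  shows "parcs (A (Suc m)) \<subseteq> pverts (A (Suc m)) \<times> pverts (A (Suc m))"
  using assms by (auto simp: Let_def)

lemma A_wf: "finite (pverts (A n)) \<and> parcs (A n) \<subseteq> pverts (A n) \<times> pverts (A n)"
proof (induction n)
  case (Suc m)
  have "pverts (A (Suc m)) = New ` {..Suc m} \<union> (\<lambda>(j, x). Copy j x) ` ({1..Suc m} \<times> pverts (A m))"
    by (auto simp: Let_def)
  then have "finite (pverts (A (Suc m)))"
    using Suc by simp
  then show ?case
    using A_arcs_in_verts Suc by blast
qed simp

lemma A_irrefl: "(u, u) \<notin> parcs (A n)"
proof (induction n arbitrary: u)
  case (Suc m)
  then show ?case by (auto simp: Let_def)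
qed simp

lemma A_tour:
  "u \<in> pverts (A n) \<Longrightarrow> v \<in> pverts (A n) \<Longrightarrow> u \<noteq> v \<Longrightarrow>
    ((u, v) \<in> parcs (A n)) \<noteq> ((v, u) \<in> parcs (A n))"
proof (induction n arbitrary: u v)
  case (Suc m)
  note IH = Suc.IH and irr = A_irrefl[of _ m]
  show ?case
  proof (cases u; cases v)
    fix i j assume "u = New i" "v = New j"
    then show ?thesis using Suc.prems by (simp add: Let_def) linarith
  next
    fix i j x assume "u = New i" "v = Copy j x"
    then show ?thesis using Suc.prems by (simp add: Let_def) linarith
  next
    fix i j x assume "u = Copy j x" "v = New i"
    then show ?thesis using Suc.prems by (simp add: Let_def) linarith
  next
    fix i j x y assume "u = Copy i x" "v = Copy j y"
    then show ?thesis using Suc.prems IH[of x y] irr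
      by (cases i j rule: linorder_cases) (simp_all add: Let_def)
  qed
qed simp

lemma tournament_A: "tournament (A n)"
proof -
  have "finite (parcs (A n))"
    using A_wf[of n] finite_subset by blast
  then have "pair_digraph (A n)"
    using A_wf[of n] A_irrefl[of _ n] by unfold_locales auto
  then show ?thesis
    using A_tour unfolding tournament_def by blast
qed

definition acyclic_digraph :: "('a, 'b) pre_digraph \<Rightarrow> bool" where
  "acyclic_digraph D \<longleftrightarrow> \<not> (\<exists>p. pre_digraph.cycle D p)"

text \<open>
  On a finite loopless digraph the partition into singletons shows that such a \<open>k\<close> exists;
  otherwise the value of \<open>LEAST\<close> is meaningless.
\<close>

definition dichromatic_number :: "'a pair_pre_digraph \<Rightarrow> nat" where
  "dichromatic_number D = (LEAST k. \<exists>P. partition_on (pverts D) P \<and> finite P \<and> card P = k \<and>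
     (\<forall>X \<in> P. acyclic_digraph (with_proj D \<restriction> X)))"

text \<open>
  The underlying undirected graph is represented by the symmetric digraph \<^const>\<open>mk_symmetric\<close>.
  In it, \<^const>\<open>pre_digraph.cycle\<close> also counts the closed walk \<open>u, v, u\<close> traversing a single
  edge, so the bound \<open>3 \<le> length p\<close> leaves exactly the cycles of the undirected graph.
  The infimum of the empty set is \<open>\<infinity>\<close>.
\<close>

definition girth :: "'a pair_pre_digraph \<Rightarrow> enat" where
  "girth D = Inf {enat (length p) | p.
     pre_digraph.cycle (with_proj (mk_symmetric (with_proj D))) p \<and> 3 \<le> length p}"

end

theory Submission
  imports Defs
begin

text \<open>
  By induction on \<open>k\<close>, some \<open>A f\<close> contains a digraph \<open>H\<close> of girth greater than \<open>l\<close> that is not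
  covered by \<open>k\<close> acyclic sets. In \<open>A n\<close> with \<open>n\<close> huge, take the vertices \<open>v\<^sub>0, \<dots>, v\<^sub>n\<close> and a copy of
  \<open>H\<close> in every \<open>T\<^sub>j\<close>, and add arcs of \<open>A n\<close> so sparsely that no short cycle arises, but so that
  there is an arc in \<open>X \<times> Y\<close> for all linearly large \<open>X\<close>, \<open>Y\<close> with \<open>X \<Rightarrow> Y\<close> in \<open>A n\<close>. Such arcs are
  chosen greedily: among the pairs of vertices of bounded degree that are far apart, some arc hits
  a constant fraction of the at most \<open>4^|V|\<close> products \<open>X \<times> Y\<close> not yet hit, so linearly many arcs
  suffice and the degrees stay bounded.

  Suppose that \<open>k + 1\<close> acyclic sets cover the result. One of them, \<open>X\<close>, contains a constant fraction
  of the \<open>v\<^sub>i\<close>, and it meets each copy of \<open>H\<close>, which \<open>k\<close> sets do not cover. Splitting these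
  indices \<open>i\<close> into a first, middle and last third gives \<open>K \<Rightarrow> M \<Rightarrow> L \<Rightarrow> K\<close>, where \<open>K\<close> and \<open>L\<close> consist
  of vertices \<open>v\<^sub>i\<close> and \<open>M\<close> of one vertex of \<open>X\<close> from each copy \<open>T\<^sub>i\<close>. Since all pairs of halves
  of consecutive sets are joined by an arc, \<open>X\<close> contains a directed cycle.
\<close>

subsection \<open>Adding an edge without creating short cycles\<close>

text \<open>
  For symmetric \<open>R\<close> this says that the girth exceeds \<open>l\<close>. Unlike a condition on cycles, it
  mentions only walks, which need not be simple.
\<close>

definition no_short_cycle :: "nat \<Rightarrow> ('a \<times> 'a) set \<Rightarrow> bool" where
  "no_short_cycle l R \<longleftrightarrow> (\<forall>u v. (u, v) \<in> R \<longrightarrow> (\<forall>j<l. (u, v) \<notin> (R - {(u, v), (v, u)}) ^^ j))"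

lemma sym_relpow:
  fixes R :: "('a \<times> 'a) set"
  shows "sym R \<Longrightarrow> sym (R ^^ j)"
proof (induction j)
  case (Suc j)
  then have "(R ^^ j O R)\<inverse> = R O R ^^ j"
    by (simp add: converse_relcomp sym_conv_converse_eq)
  then show ?case
    by (metis relpow.simps(2) relpow_commute sym_conv_converse_eq)
qed (auto simp: sym_def)

lemma relpow_mono_rel:
  fixes R T :: "('a \<times> 'a) set"
  shows "(x, y) \<in> R ^^ j \<Longrightarrow> R \<subseteq> T \<Longrightarrow> (x, y) \<in> T ^^ j"
  by (induction j arbitrary: y) auto

text \<open>Cut the walk at its first and last use of the new edge: it first reaches an endpoint
  \<open>x\<close> inside \<open>Q\<close>, and it leaves an endpoint \<open>y\<close> for the last
  time inside \<open>Q\<close>. At least one step is dropped, hence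
  \<open>i + m < j\<close>.\<close>

lemma relpow_insert_edge:
  fixes Q :: "('a \<times> 'a) set"
  assumes "(u, v) \<in> (Q \<union> {(a, b), (b, a)}) ^^ j"
  shows "(u, v) \<in> Q ^^ j \<or> (\<exists>x\<in>{a, b}. \<exists>y\<in>{a, b}. \<exists>i m. i + m < j \<and> (u, x) \<in> Q ^^ i \<and> (y, v) \<in> Q ^^ m)"
  using assms
proof (induction j arbitrary: v)
  case (Suc j)
  then obtain w where w: "(u, w) \<in> (Q \<union> {(a, b), (b, a)}) ^^ j" "(w, v) \<in> Q \<union> {(a, b), (b, a)}"
    by auto
  consider "(u, w) \<in> Q ^^ j" "(w, v) \<in> Q" | "(u, w) \<in> Q ^^ j" "w \<in> {a, b}" "v \<in> {a, b}"
    | x y i m where "x \<in> {a, b}" "y \<in> {a, b}" "i + m < j" "(u, x) \<in> Q ^^ i" "(y, w) \<in> Q ^^ m" "(w, v) \<in> Q"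
    | x i m where "x \<in> {a, b}" "i + m < j" "(u, x) \<in> Q ^^ i" "v \<in> {a, b}"
    using Suc.IH[OF w(1)] w(2) by blast
  then show ?case
  proof cases
    case 1
    then show ?thesis by auto
  next
    case 2
    then have "j + 0 < Suc j" "(u, w) \<in> Q ^^ j" "(v, v) \<in> Q ^^ 0" by auto
    then show ?thesis using 2 by blast
  next
    case 3
    then have "i + Suc m < Suc j" "(y, v) \<in> Q ^^ Suc m" by auto
    then show ?thesis using 3 by blast
  next
    case 4
    then have "i + 0 < Suc j" "(v, v) \<in> Q ^^ 0" by auto
    then show ?thesis using 4 by blast
  qed
qed simp

text \<open>A short cycle through the new edge would join \<open>a\<close> to \<open>b\<close> by a
  short walk in \<open>R\<close>. If the removed edge \<open>uv\<close> is old, the cut walk leaves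
  pieces from \<open>u\<close> to \<open>x\<close> and from \<open>y\<close> to \<open>v\<close>.
  For \<open>x = y\<close> they already close a short cycle in \<open>R\<close>. Otherwise they are
  reversed and linked by \<open>uv\<close> into a walk between \<open>a\<close> and
  \<open>b\<close>.\<close>

lemma no_short_cycle_insert:
  assumes R: "sym R" "no_short_cycle l R" and far: "\<And>j. j < l \<Longrightarrow> (a, b) \<notin> R ^^ j"
  shows "no_short_cycle l (R \<union> {(a, b), (b, a)})"
  unfolding no_short_cycle_def
proof (intro allI impI notI)
  fix u v j
  assume uv: "(u, v) \<in> R \<union> {(a, b), (b, a)}" and j: "j < l"
    and w: "(u, v) \<in> (R \<union> {(a, b), (b, a)} - {(u, v), (v, u)}) ^^ j"
  show False
  proof (cases "(u, v) \<in> {(a, b), (b, a)}")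
    case True
    then have "R \<union> {(a, b), (b, a)} - {(u, v), (v, u)} \<subseteq> R" by auto
    with w have "(u, v) \<in> R ^^ j" by (rule relpow_mono_rel)
    then have "(a, b) \<in> R ^^ j"
      using True sym_relpow[OF R(1)] by (auto dest: symD)
    then show False using far j by blast
  next
    case False
    let ?Q = "R - {(u, v), (v, u)}"
    have uvR: "(u, v) \<in> R" using False uv by auto
    have "R \<union> {(a, b), (b, a)} - {(u, v), (v, u)} \<subseteq> ?Q \<union> {(a, b), (b, a)}" by auto
    with w have "(u, v) \<in> (?Q \<union> {(a, b), (b, a)}) ^^ j" by (rule relpow_mono_rel)
    from relpow_insert_edge[OF this] R(2) uvR j
    obtain x y i m where xy: "x \<in> {a, b}" "y \<in> {a, b}" "i + m < j"
      and q: "(u, x) \<in> ?Q ^^ i" "(y, v) \<in> ?Q ^^ m"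
      unfolding no_short_cycle_def by blast
    show False
    proof (cases "x = y")
      case True
      then have "(u, v) \<in> ?Q ^^ (i + m)"
        using q by (auto simp: relpow_add)
      then show False
        using R(2) uvR j xy(3) unfolding no_short_cycle_def by (meson less_trans)
    next
      case False
      have "(u, x) \<in> R ^^ i" "(y, v) \<in> R ^^ m"
        using q by (auto elim: relpow_mono_rel)
      then have "(x, u) \<in> R ^^ i" "(v, y) \<in> R ^^ m"
        using sym_relpow[OF R(1)] by (auto dest: symD)
      then have "(x, y) \<in> R ^^ (i + (1 + m))"
        using uvR unfolding relpow_add relpow_1 by blast
      then have "(a, b) \<in> R ^^ (i + (1 + m))"
        using False xy symD[OF sym_relpow[OF R(1)]] by blast
      moreover have "i + (1 + m) < l" using xy(3) j by simp
      ultimately show False using far by blast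
    qed
  qed
qed

subsection \<open>The greedy choice of arcs\<close>

lemma card_relpow_Image_le:
  fixes T :: "('a \<times> 'a) set"
  assumes "\<And>u. finite (T `` {u})" "\<And>u. card (T `` {u}) \<le> M"
  shows "finite ((T ^^ j) `` {u}) \<and> card ((T ^^ j) `` {u}) \<le> M ^ j"
proof (induction j)
  case (Suc j)
  have eq: "(T ^^ Suc j) `` {u} = (\<Union>w\<in>(T ^^ j) `` {u}. T `` {w})" by auto
  have "card ((T ^^ Suc j) `` {u}) \<le> (\<Sum>w\<in>(T ^^ j) `` {u}. card (T `` {w}))"
    unfolding eq using Suc by (intro card_UN_le) auto
  also have "\<dots> \<le> (\<Sum>w\<in>(T ^^ j) `` {u}. M)" by (intro sum_mono assms)
  also have "\<dots> \<le> M ^ Suc j" using Suc by simp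
  finally show ?case unfolding eq using Suc assms(1) by auto
qed simp

lemma card_close_pairs_le:
  fixes T :: "('a \<times> 'a) set"
  assumes "finite V" "\<And>u. finite (T `` {u})" "\<And>u. card (T `` {u}) \<le> M" "M \<ge> 1"
  shows "card {p \<in> V \<times> V. \<exists>j<l. p \<in> T ^^ j} \<le> card V * (l * M ^ l)"
proof -
  have sub: "{p \<in> V \<times> V. \<exists>j<l. p \<in> T ^^ j} \<subseteq> (SIGMA u:V. \<Union>j<l. (T ^^ j) `` {u})" by auto
  have fin: "finite (\<Union>j<l. (T ^^ j) `` {u})" for u
    using card_relpow_Image_le[of T M] assms(2,3) by blast
  have "card (\<Union>j<l. (T ^^ j) `` {u}) \<le> l * M ^ l" for u
  proof -
    have "card (\<Union>j<l. (T ^^ j) `` {u}) \<le> (\<Sum>j<l. card ((T ^^ j) `` {u}))"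
      by (intro card_UN_le) auto
    also have "\<dots> \<le> (\<Sum>j<l. M ^ l)"
    proof (rule sum_mono)
      fix j assume "j \<in> {..<l}"
      then have "M ^ j \<le> M ^ l" using assms(4) by (intro power_increasing) auto
      then show "card ((T ^^ j) `` {u}) \<le> M ^ l"
        using card_relpow_Image_le[of T M j u] assms(2,3) by force
    qed
    finally show ?thesis by simp
  qed
  then have "(\<Sum>u\<in>V. card (\<Union>j<l. (T ^^ j) `` {u})) \<le> card V * (l * M ^ l)"
    using sum_bounded_above[of V "\<lambda>u. card (\<Union>j<l. (T ^^ j) `` {u})" "l * M ^ l"] by simp
  moreover have "card (SIGMA u:V. \<Union>j<l. (T ^^ j) `` {u}) = (\<Sum>u\<in>V. card (\<Union>j<l. (T ^^ j) `` {u}))"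
    using assms(1) fin by (intro card_SigmaI) auto
  moreover have "card {p \<in> V \<times> V. \<exists>j<l. p \<in> T ^^ j} \<le> card (SIGMA u:V. \<Union>j<l. (T ^^ j) `` {u})"
    using assms(1) fin by (intro card_mono[OF _ sub]) auto
  ultimately show ?thesis by linarith
qed

text \<open>Handshake bound: each arc of \<open>S\<close> adds at most two to the sum of the
  degrees.\<close>

lemma card_high_degree_le:
  assumes "finite V" "S \<subseteq> V \<times> V"
  shows "card {u \<in> V. d \<le> card ((S \<union> S\<inverse>) `` {u})} * d \<le> 2 * card S"
proof -
  let ?S = "S \<union> S\<inverse>" and ?W = "{u \<in> V. d \<le> card ((S \<union> S\<inverse>) `` {u})}"
  have fS: "finite S" using assms finite_subset by blast
  have "card ?W * d \<le> (\<Sum>u\<in>?W. card (?S `` {u}))"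
    using sum_bounded_below[of ?W d "\<lambda>u. card (?S `` {u})"] by auto
  also have "\<dots> = card (SIGMA u:?W. ?S `` {u})"
    using assms(1) fS by (intro card_SigmaI[symmetric]) auto
  also have "\<dots> \<le> card ?S"
    using fS by (intro card_mono) auto
  also have "\<dots> \<le> card S + card (S\<inverse>)" by (rule card_Un_le)
  finally show ?thesis by simp
qed

text \<open>Averaging over \<open>P\<close> after double counting the incidences
  \<open>I e f\<close>, of which there are at least \<open>card F * c\<close>.\<close>

lemma ex_popular_element:
  fixes c :: real
  assumes "finite F" "F \<noteq> {}" "finite P" "c > 0"
    and hit: "\<And>f. f \<in> F \<Longrightarrow> c \<le> card {e \<in> P. I e f}"
  shows "\<exists>e\<in>P. card F * c \<le> card P * real (card {f \<in> F. I e f})"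
proof (rule ccontr)
  assume "\<not> ?thesis"
  then have less: "card P * real (card {f \<in> F. I e f}) < card F * c" if "e \<in> P" for e
    using that by (auto simp: not_le)
  obtain f where "f \<in> F" using assms(2) by auto
  then have "card {e \<in> P. I e f} > 0" using hit[of f] assms(4) by linarith
  then have "P \<noteq> {}" by auto
  then have "card P * (card F * c) > (\<Sum>e\<in>P. card P * real (card {f \<in> F. I e f}))"
    using sum_strict_mono[OF assms(3), of "\<lambda>e. card P * real (card {f \<in> F. I e f})" "\<lambda>_. card F * c"] less
    by simp
  moreover have "(\<Sum>e\<in>P. card P * real (card {f \<in> F. I e f})) = card P * real (\<Sum>e\<in>P. card {f \<in> F. I e f})"
    by (simp add: sum_distrib_left)
  moreover have "(\<Sum>e\<in>P. card {f \<in> F. I e f}) = (\<Sum>f\<in>F. card {e \<in> P. I e f})"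
    using sum.swap_restrict[OF assms(3,1), of "\<lambda>_ _. 1::nat" I] by simp
  moreover have "real (\<Sum>f\<in>F. card {e \<in> P. I e f}) \<ge> card F * c"
    using sum_bounded_below[of F c "\<lambda>f. real (card {e \<in> P. I e f})"] hit by simp
  ultimately have "card P * (card F * c) > card P * (card F * c)"
    by (smt (verit) mult_left_mono of_nat_0_le_iff)
  then show False by simp
qed

text \<open>Here \<open>R\<close> is the current graph, \<open>W\<close> contains the saturated
  vertices and \<open>U\<close> consists of products still to be hit. With
  \<open>n = card V\<close>, pairs that touch \<open>W\<close> and pairs that are close in
  \<open>R\<close> number at most \<open>\<epsilon>\<^sup>2 / 4 * n\<^sup>2\<close> each. A product
  in \<open>U\<close> has at least \<open>\<epsilon>\<^sup>2 * n\<^sup>2\<close> pairs, so at least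
  half that many are admissible. Averaging over the at most \<open>n\<^sup>2\<close> admissible
  pairs yields one that lies in a fraction \<open>\<epsilon>\<^sup>2 / 2\<close> of the
  products.\<close>

lemma ex_good_arc:
  fixes \<epsilon> :: real
  assumes V: "finite V" "V \<noteq> {}" and \<epsilon>: "\<epsilon> > 0"
    and deg: "\<And>u. finite (R `` {u})" "\<And>u. card (R `` {u}) \<le> M" "M \<ge> 1"
    and large: "4 * (l * M ^ l) \<le> \<epsilon>\<^sup>2 * card V"
    and W: "W \<subseteq> V" "card W \<le> \<epsilon>\<^sup>2 / 8 * card V"
    and U: "finite U" "U \<noteq> {}"
      "\<And>X Y. (X, Y) \<in> U \<Longrightarrow> X \<subseteq> V \<and> Y \<subseteq> V \<and> \<epsilon> * card V \<le> card X \<and> \<epsilon> * card V \<le> card Y"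
  shows "\<exists>a\<in>V - W. \<exists>b\<in>V - W. (\<forall>j<l. (a, b) \<notin> R ^^ j) \<and> (\<exists>(X, Y)\<in>U. (a, b) \<in> X \<times> Y) \<and>
      card {(X, Y) \<in> U. (a, b) \<notin> X \<times> Y} \<le> (1 - \<epsilon>\<^sup>2 / 2) * card U"
proof -
  let ?n = "card V"
  define Cl where "Cl = {p \<in> V \<times> V. \<exists>j<l. p \<in> R ^^ j}"
  define P where "P = (V - W) \<times> (V - W) - Cl"
  have n: "?n > 0" using V by (simp add: card_gt_0_iff)
  have fP: "finite P" unfolding P_def using V by auto
  have cP: "card P \<le> ?n * ?n"
    using card_mono[of "V \<times> V" P] V unfolding P_def by (auto simp: card_cartesian_product)
  have fW: "finite W" using W V finite_subset by blast
  define B where "B = W \<times> V \<union> V \<times> W \<union> Cl"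
  have "real (card Cl) \<le> real ?n * (l * M ^ l)"
    using card_close_pairs_le[of V R M l] V deg unfolding Cl_def
    by (metis (no_types, lifting) of_nat_le_iff of_nat_mult)
  also have "\<dots> \<le> real ?n * (\<epsilon>\<^sup>2 * ?n / 4)"
    using large by (intro mult_left_mono) auto
  finally have cl: "real (card Cl) \<le> \<epsilon>\<^sup>2 / 4 * (real ?n)\<^sup>2"
    by (simp add: power2_eq_square algebra_simps)
  have "card B \<le> card W * ?n + ?n * card W + card Cl"
    unfolding B_def by (metis add_mono card_Un_le card_cartesian_product le_refl order_trans)
  then have "real (card B) \<le> real (card W * ?n + ?n * card W + card Cl)"
    by (rule of_nat_mono)
  also have "\<dots> = 2 * (real (card W) * real ?n) + real (card Cl)" by simp
  also have "\<dots> \<le> 2 * (\<epsilon>\<^sup>2 / 8 * ?n * ?n) + \<epsilon>\<^sup>2 / 4 * (real ?n)\<^sup>2"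
    using cl mult_right_mono[OF W(2), of ?n] by linarith
  finally have cB: "card B \<le> \<epsilon>\<^sup>2 / 2 * (real ?n)\<^sup>2"
    by (simp add: power2_eq_square algebra_simps)
  have fB: "finite B" unfolding B_def Cl_def using V fW by auto
  define c where "c = \<epsilon>\<^sup>2 / 2 * (real ?n)\<^sup>2"
  have c: "c > 0" unfolding c_def using \<epsilon> n by simp
  have hit: "c \<le> card {e \<in> P. case f of (X, Y) \<Rightarrow> e \<in> X \<times> Y}" if f: "f \<in> U" for f
  proof -
    obtain X Y where XY: "f = (X, Y)" by force
    note u = U(3)[of X Y] f[unfolded XY]
    have "X \<times> Y - B \<subseteq> {e \<in> P. case f of (X, Y) \<Rightarrow> e \<in> X \<times> Y}"
      using u unfolding XY P_def B_def by auto
    then have "card (X \<times> Y - B) \<le> card {e \<in> P. case f of (X, Y) \<Rightarrow> e \<in> X \<times> Y}"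
      using fP by (intro card_mono) auto
    moreover have "card (X \<times> Y) - card B \<le> card (X \<times> Y - B)"
      using fB by (intro diff_card_le_card_Diff) auto
    moreover have "\<epsilon>\<^sup>2 * (real ?n)\<^sup>2 \<le> card (X \<times> Y)"
      using mult_mono[of "\<epsilon> * ?n" "card X" "\<epsilon> * ?n" "card Y"] u \<epsilon>
      by (simp add: card_cartesian_product power2_eq_square algebra_simps)
    ultimately show ?thesis using cB unfolding c_def by linarith
  qed
  obtain e where e: "e \<in> P" "card U * c \<le> card P * real (card {f \<in> U. case f of (X, Y) \<Rightarrow> e \<in> X \<times> Y})"
    using ex_popular_element[OF U(1,2) fP c, where I = "\<lambda>e f. case f of (X, Y) \<Rightarrow> e \<in> X \<times> Y"] hit by blast
  obtain a b where ab: "e = (a, b)" by force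
  let ?H = "{f \<in> U. case f of (X, Y) \<Rightarrow> e \<in> X \<times> Y}"
  have "card U * c \<le> real (?n * ?n) * real (card ?H)"
    using e(2) mult_right_mono[OF of_nat_mono[OF cP], of "real (card ?H)"] by linarith
  then have "(real ?n)\<^sup>2 * (\<epsilon>\<^sup>2 / 2 * card U) \<le> (real ?n)\<^sup>2 * card ?H"
    unfolding c_def by (simp add: power2_eq_square algebra_simps)
  then have H: "\<epsilon>\<^sup>2 / 2 * card U \<le> card ?H" using n by simp
  moreover have "\<epsilon>\<^sup>2 / 2 * card U > 0" using \<epsilon> U by (simp add: card_gt_0_iff)
  ultimately have "?H \<noteq> {}" by (metis card.empty less_le_not_le of_nat_0)
  have "{(X, Y) \<in> U. (a, b) \<notin> X \<times> Y} = U - ?H" using ab by auto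
  then have "card {(X, Y) \<in> U. (a, b) \<notin> X \<times> Y} = card U - card ?H"
    using U(1) by (simp add: card_Diff_subset)
  moreover have "card ?H \<le> card U" using U(1) by (intro card_mono) auto
  ultimately have "card {(X, Y) \<in> U. (a, b) \<notin> X \<times> Y} \<le> (1 - \<epsilon>\<^sup>2 / 2) * card U"
    using H by (simp add: of_nat_diff algebra_simps)
  moreover have "a \<in> V - W" "b \<in> V - W" "\<forall>j<l. (a, b) \<notin> R ^^ j"
    using e(1) unfolding P_def ab Cl_def by auto
  moreover have "\<exists>(X, Y)\<in>U. (a, b) \<in> X \<times> Y" using \<open>?H \<noteq> {}\<close> ab by auto
  ultimately show ?thesis by blast
qed

definition hits_large_products :: "real \<Rightarrow> 'a set \<Rightarrow> ('a \<times> 'a) set \<Rightarrow> ('a \<times> 'a) set \<Rightarrow> bool" where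
  "hits_large_products \<epsilon> V E S \<longleftrightarrow>
    (\<forall>X Y. X \<subseteq> V \<and> Y \<subseteq> V \<and> X \<times> Y \<subseteq> E \<and> \<epsilon> * card V \<le> card X \<and> \<epsilon> * card V \<le> card Y \<longrightarrow>
      S \<inter> X \<times> Y \<noteq> {})"

text \<open>The threshold \<open>N\<close> depends only on \<epsilon>, \<open>D\<close> and
  \<open>l\<close>, so the host graph can be chosen after it. Only products inside \<open>E\<close>
  have to be hit, which makes every chosen arc an arc of \<open>E\<close>.\<close>

lemma sparse_hitting_arcs:
  fixes \<epsilon> :: real and D l :: nat
  assumes \<epsilon>: "0 < \<epsilon>" "\<epsilon> \<le> 1"
  obtains N where "\<And>V (R :: ('a \<times> 'a) set) E. finite V \<Longrightarrow> N \<le> card V \<Longrightarrow> R \<subseteq> V \<times> V \<Longrightarrow> sym R \<Longrightarrow>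
    no_short_cycle l R \<Longrightarrow> (\<And>u. card (R `` {u}) \<le> D) \<Longrightarrow>
    \<exists>S. S \<subseteq> E \<and> S \<subseteq> V \<times> V \<and> no_short_cycle l (R \<union> S \<union> S\<inverse>) \<and> hits_large_products \<epsilon> V E S"
proof -
  define q where "q = 1 - \<epsilon>\<^sup>2 / 2"
  have \<epsilon>2: "0 < \<epsilon>\<^sup>2" "\<epsilon>\<^sup>2 \<le> 1" using \<epsilon> by (auto simp: power_le_one)
  then have q: "0 \<le> q" "q < 1" unfolding q_def by auto
  \<comment> \<open>After \<open>C * card V\<close> rounds, each keeping at most a fraction
    \<open>q\<close>, fewer than one of the at most \<open>4 ^ card V\<close> products is
    left.\<close>
  obtain C where C: "q ^ C < 1 / 4" using real_arch_pow_inv[of "1/4" q] q by auto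
  \<comment> \<open>So many arcs can give degree \<open>d\<close> to at most
    \<open>\<epsilon>\<^sup>2 / 8 * card V\<close> vertices. The summand 1 ensures
    \<open>d \<ge> 1\<close>.\<close>
  obtain d :: nat where d: "16 * C / \<epsilon>\<^sup>2 + 1 \<le> d" using real_arch_simple by blast
  have "0 \<le> 16 * C / \<epsilon>\<^sup>2" by simp
  then have d1: "d \<ge> 1" using d by linarith
  have d2: "16 * C \<le> \<epsilon>\<^sup>2 * d"
  proof -
    have "16 * C / \<epsilon>\<^sup>2 \<le> d" using d by linarith
    then show ?thesis using \<epsilon>2 by (simp add: divide_le_eq algebra_simps)
  qed
  define M where "M = D + d"
  \<comment> \<open>All degrees stay at most \<open>M\<close>, so beyond this size the close pairs
    are few enough for \<open>ex_good_arc\<close>. The summand 1 makes \<open>V\<close>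
    nonempty.\<close>
  obtain N :: nat where N: "4 * (l * M ^ l) / \<epsilon>\<^sup>2 + 1 \<le> N" using real_arch_simple by blast
  have main: "\<exists>S. S \<subseteq> E \<and> S \<subseteq> V \<times> V \<and> no_short_cycle l (R \<union> S \<union> S\<inverse>) \<and> hits_large_products \<epsilon> V E S"
    if V: "finite V" "N \<le> card V" and R: "R \<subseteq> V \<times> V" "sym R" "no_short_cycle l R"
      and D: "\<And>u. card (R `` {u}) \<le> D" for V and R E :: "('a \<times> 'a) set"
  proof -
    let ?n = "card V"
    have "4 * (l * M ^ l) / \<epsilon>\<^sup>2 + 1 \<le> ?n" using N V(2) by linarith
    moreover have "0 \<le> 4 * (l * M ^ l) / \<epsilon>\<^sup>2" by simp
    ultimately have n: "?n > 0" and "4 * (l * M ^ l) / \<epsilon>\<^sup>2 \<le> ?n" by linarith+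
    then have large: "4 * (l * M ^ l) \<le> \<epsilon>\<^sup>2 * ?n"
      using \<epsilon>2 by (simp add: divide_le_eq algebra_simps)
    have V0: "V \<noteq> {}" using n by auto
    define F where "F = {(X, Y). X \<subseteq> V \<and> Y \<subseteq> V \<and> X \<times> Y \<subseteq> E \<and>
      \<epsilon> * card V \<le> card X \<and> \<epsilon> * card V \<le> card Y}"
    define unhit where "unhit = (\<lambda>S. {(X, Y) \<in> F. S \<inter> X \<times> Y = {}})"
    have F: "F \<subseteq> Pow V \<times> Pow V" unfolding F_def by auto
    have fF: "finite F" using F V(1) finite_subset by blast
    have "card F \<le> card (Pow V \<times> Pow V)" using F V(1) by (intro card_mono) auto
    also have "\<dots> = 4 ^ ?n"
      using V(1) by (simp add: card_cartesian_product card_Pow flip: power_mult_distrib)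
    finally have cF: "card F \<le> 4 ^ ?n" .
    \<comment> \<open>The greedy process after \<open>t\<close> rounds. It may stop early once all
      products are hit, hence only \<open>card S \<le> t\<close>. The bound on \<open>t\<close>
      keeps the saturated vertices few.\<close>
    have "\<exists>S. S \<subseteq> E \<and> S \<subseteq> V \<times> V \<and> card S \<le> t \<and> no_short_cycle l (R \<union> S \<union> S\<inverse>) \<and>
        (\<forall>u. card ((S \<union> S\<inverse>) `` {u}) \<le> d) \<and> card (unhit S) \<le> q ^ t * 4 ^ ?n"
      if "t \<le> C * ?n" for t
      using that
    proof (induction t)
      case 0
      have "unhit {} = F" unfolding unhit_def by auto
      then have "real (card (unhit {})) \<le> 4 ^ ?n" using cF by (metis of_nat_le_iff of_nat_numeral of_nat_power)
      then show ?case using R(3) by (intro exI[of _ "{}"]) auto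
    next
      case (Suc t)
      then obtain S where S: "S \<subseteq> E" "S \<subseteq> V \<times> V" "card S \<le> t" "no_short_cycle l (R \<union> S \<union> S\<inverse>)"
        "\<And>u. card ((S \<union> S\<inverse>) `` {u}) \<le> d" "card (unhit S) \<le> q ^ t * 4 ^ ?n"
        by auto
      show ?case
      proof (cases "unhit S = {}")
        case True
        then have "card (unhit S) \<le> q ^ Suc t * 4 ^ ?n" using q by simp
        moreover have "card S \<le> Suc t" using S(3) by simp
        ultimately show ?thesis using S by blast
      next
        case False
        let ?R = "R \<union> S \<union> S\<inverse>"
        \<comment> \<open>Saturated vertices are barred as endpoints, so the next arc cannot push a
          degree above \<open>d\<close>.\<close>
        define W where "W = {u \<in> V. d \<le> card ((S \<union> S\<inverse>) `` {u})}"
        have RV: "?R \<subseteq> V \<times> V" using R(1) S(2) by auto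
        have fR: "finite (?R `` {u})" for u
          using finite_subset[of "?R `` {u}" V] RV V(1) by blast
        have dR: "card (?R `` {u}) \<le> M" for u
        proof -
          have "card (?R `` {u}) = card (R `` {u} \<union> (S \<union> S\<inverse>) `` {u})" by (rule arg_cong[of _ _ card]) auto
          then show ?thesis
            using card_Un_le[of "R `` {u}" "(S \<union> S\<inverse>) `` {u}"] D[of u] S(5)[of u] unfolding M_def by linarith
        qed
        have "card W * d \<le> 2 * card S"
          using card_high_degree_le[OF V(1) S(2)] unfolding W_def .
        also have "\<dots> \<le> 2 * (C * ?n)" using S(3) Suc.prems by simp
        finally have "real (card W * d) \<le> real (2 * (C * ?n))" by (rule of_nat_mono)
        then have "real (card W) * d * 8 \<le> 16 * real C * ?n" by (simp add: algebra_simps)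
        also have "\<dots> \<le> \<epsilon>\<^sup>2 * d * ?n" using d2 by (intro mult_right_mono) auto
        finally have "d * (8 * real (card W)) \<le> d * (\<epsilon>\<^sup>2 * ?n)" by (simp add: algebra_simps)
        then have cW: "card W \<le> \<epsilon>\<^sup>2 / 8 * ?n" using d1 by simp
        have fU: "finite (unhit S)" using fF unfolding unhit_def by (rule rev_finite_subset) auto
        have "\<exists>a\<in>V - W. \<exists>b\<in>V - W. (\<forall>j<l. (a, b) \<notin> ?R ^^ j) \<and> (\<exists>(X, Y)\<in>unhit S. (a, b) \<in> X \<times> Y) \<and>
          card {(X, Y) \<in> unhit S. (a, b) \<notin> X \<times> Y} \<le> (1 - \<epsilon>\<^sup>2 / 2) * card (unhit S)"
          using large d1 False
          by (intro ex_good_arc[OF V(1) V0 \<epsilon>(1) fR dR _ _ _ cW fU]) (auto simp: M_def W_def unhit_def F_def)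
        then obtain a b where ab: "a \<in> V - W" "b \<in> V - W" "\<And>j. j < l \<Longrightarrow> (a, b) \<notin> ?R ^^ j"
          and abE: "\<exists>(X, Y)\<in>unhit S. (a, b) \<in> X \<times> Y"
          and less: "card {(X, Y) \<in> unhit S. (a, b) \<notin> X \<times> Y} \<le> q * card (unhit S)"
          unfolding q_def by blast
        let ?S = "insert (a, b) S"
        have fS: "finite S" using S(2) V(1) finite_subset by blast
        have "no_short_cycle l (?R \<union> {(a, b), (b, a)})"
          using R(2) by (intro no_short_cycle_insert[OF _ S(4) ab(3)]) (auto simp: sym_def)
        moreover have "?R \<union> {(a, b), (b, a)} = R \<union> ?S \<union> ?S\<inverse>" by auto
        ultimately have 1: "no_short_cycle l (R \<union> ?S \<union> ?S\<inverse>)" by simp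
        have 2: "card ((?S \<union> ?S\<inverse>) `` {u}) \<le> d" for u
        proof (cases "u \<in> {a, b}")
          case True
          have "card ((?S \<union> ?S\<inverse>) `` {u}) \<le> card (insert (if u = a then b else a) ((S \<union> S\<inverse>) `` {u}))"
            using fS True by (intro card_mono) auto
          also have "\<dots> \<le> Suc (card ((S \<union> S\<inverse>) `` {u}))" by (rule card_insert_le_m1) auto
          also have "\<dots> \<le> d" using ab(1,2) True unfolding W_def by auto
          finally show ?thesis .
        next
          case False
          then have "(?S \<union> ?S\<inverse>) `` {u} = (S \<union> S\<inverse>) `` {u}" by auto
          then show ?thesis using S(5) by simp
        qed
        have "card (unhit ?S) \<le> card {(X, Y) \<in> unhit S. (a, b) \<notin> X \<times> Y}"
          using fU by (intro card_mono) (auto simp: unhit_def elim: rev_finite_subset)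
        then have "card (unhit ?S) \<le> q * card (unhit S)" using less by linarith
        also have "\<dots> \<le> q * (q ^ t * 4 ^ ?n)" using S(6) q by (intro mult_left_mono) auto
        finally have 3: "card (unhit ?S) \<le> q ^ Suc t * 4 ^ ?n" by simp
        have "?S \<subseteq> E" using S(1) abE unfolding unhit_def F_def by auto
        moreover have "?S \<subseteq> V \<times> V" using S(2) ab by auto
        moreover have "card ?S \<le> Suc t" using S(3) fS by (simp add: card_insert_if)
        ultimately show ?thesis using 1 2 3 by blast
      qed
    qed
    from this[of "C * ?n"] obtain S where S: "S \<subseteq> E" "S \<subseteq> V \<times> V" "no_short_cycle l (R \<union> S \<union> S\<inverse>)"
      "card (unhit S) \<le> q ^ (C * ?n) * 4 ^ ?n" by auto
    have "q ^ (C * ?n) * 4 ^ ?n = (q ^ C * 4) ^ ?n" by (simp add: power_mult power_mult_distrib)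
    also have "\<dots> < 1" using C q n by (subst power_less_one_iff) auto
    finally have "card (unhit S) = 0" using S(4) by simp
    moreover have "finite (unhit S)" using fF unfolding unhit_def by (rule rev_finite_subset) auto
    ultimately have "unhit S = {}" by simp
    then have "hits_large_products \<epsilon> V E S"
      unfolding hits_large_products_def unhit_def F_def by blast
    then show ?thesis using S(1-3) by blast
  qed
  show thesis by (rule that[of N]) (rule main)
qed

subsection \<open>Acyclicity and medians\<close>

text \<open>Take the least \<open>m\<close> for which at least half of the values are at most
  \<open>m\<close>. By minimality at most half are below \<open>m\<close>.\<close>

lemma nat_valued_median:
  fixes f :: "'a \<Rightarrow> nat"
  assumes "finite K" "K \<noteq> {}"
  shows "\<exists>m. card K \<le> 2 * card {x \<in> K. f x \<le> m} \<and> card K \<le> 2 * card {x \<in> K. m \<le> f x}"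
proof -
  let ?P = "\<lambda>m. card K \<le> 2 * card {x \<in> K. f x \<le> m}"
  define m where "m = (LEAST m. ?P m)"
  have "{x \<in> K. f x \<le> Max (f ` K)} = K" using assms by auto
  then have "?P (Max (f ` K))" by simp
  then have 1: "?P m" unfolding m_def by (rule LeastI)
  have "2 * card {x \<in> K. f x < m} \<le> card K"
  proof (cases m)
    case (Suc m')
    then have "\<not> ?P m'" using not_less_Least[of m' ?P] unfolding m_def by simp
    then show ?thesis using Suc by (simp add: less_Suc_eq_le)
  qed simp
  moreover have "card K = card {x \<in> K. f x < m} + card {x \<in> K. m \<le> f x}"
    using assms(1) by (subst card_Un_disjoint[symmetric]) (auto intro!: arg_cong[of _ _ card])
  ultimately show ?thesis using 1 by (intro exI[of _ m]) linarith
qed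

text \<open>The rank counts the reachable elements. It drops along an arc from \<open>x\<close> to
  \<open>y\<close> because \<open>y\<close> is reachable from \<open>x\<close> but not from
  itself.\<close>

lemma finite_acyclic_rank:
  assumes "finite r" "acyclic r"
  obtains f :: "'a \<Rightarrow> nat" where "\<And>x y. (x, y) \<in> r \<Longrightarrow> f y < f x"
proof
  fix x y assume xy: "(x, y) \<in> r"
  have "r\<^sup>+ `` {y} \<subset> r\<^sup>+ `` {x}"
    using xy assms(2) unfolding acyclic_def by (auto intro: trancl_into_trancl2)
  moreover have "finite (r\<^sup>+ `` {x})" using assms(1) by (simp add: finite_Image)
  ultimately show "card (r\<^sup>+ `` {y}) < card (r\<^sup>+ `` {x})" by (rule psubset_card_mono[rotated])
qed

text \<open>
  Along an acyclic relation some rank function decreases, so an arc from the lower half of \<open>K\<close> to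
  the upper half of \<open>B\<close> forces the median rank of \<open>B\<close> below that of \<open>K\<close>.
\<close>

lemma not_acyclic_if_dense_triple:
  assumes fin: "finite r" "finite K" "finite B" "finite C" and ne: "K \<noteq> {}" "B \<noteq> {}" "C \<noteq> {}"
    and AB: "\<And>X Y. X \<subseteq> K \<Longrightarrow> Y \<subseteq> B \<Longrightarrow> card K \<le> 2 * card X \<Longrightarrow> card B \<le> 2 * card Y \<Longrightarrow> r \<inter> X \<times> Y \<noteq> {}"
    and BC: "\<And>X Y. X \<subseteq> B \<Longrightarrow> Y \<subseteq> C \<Longrightarrow> card B \<le> 2 * card X \<Longrightarrow> card C \<le> 2 * card Y \<Longrightarrow> r \<inter> X \<times> Y \<noteq> {}"
    and CA: "\<And>X Y. X \<subseteq> C \<Longrightarrow> Y \<subseteq> K \<Longrightarrow> card C \<le> 2 * card X \<Longrightarrow> card K \<le> 2 * card Y \<Longrightarrow> r \<inter> X \<times> Y \<noteq> {}"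
  shows "\<not> acyclic r"
proof
  assume "acyclic r"
  then obtain f :: "'a \<Rightarrow> nat" where f: "\<And>x y. (x, y) \<in> r \<Longrightarrow> f y < f x"
    using finite_acyclic_rank fin(1) by blast
  have less: "m' < m"
    if "\<And>X Y. X \<subseteq> K' \<Longrightarrow> Y \<subseteq> B' \<Longrightarrow> card K' \<le> 2 * card X \<Longrightarrow> card B' \<le> 2 * card Y \<Longrightarrow> r \<inter> X \<times> Y \<noteq> {}"
      "card K' \<le> 2 * card {x \<in> K'. f x \<le> m}" "card B' \<le> 2 * card {x \<in> B'. m' \<le> f x}" for K' B' m m'
    using that(1)[of "{x \<in> K'. f x \<le> m}" "{x \<in> B'. m' \<le> f x}"] that(2,3) f by fastforce
  obtain a where a: "card K \<le> 2 * card {x \<in> K. f x \<le> a}" "card K \<le> 2 * card {x \<in> K. a \<le> f x}"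
    using nat_valued_median[OF fin(2) ne(1)] by blast
  obtain b where b: "card B \<le> 2 * card {x \<in> B. f x \<le> b}" "card B \<le> 2 * card {x \<in> B. b \<le> f x}"
    using nat_valued_median[OF fin(3) ne(2)] by blast
  obtain c where c: "card C \<le> 2 * card {x \<in> C. f x \<le> c}" "card C \<le> 2 * card {x \<in> C. c \<le> f x}"
    using nat_valued_median[OF fin(4) ne(3)] by blast
  have "b < a" by (rule less[OF AB a(1) b(2)])
  moreover have "c < b" by (rule less[OF BC b(1) c(2)])
  moreover have "a < c" by (rule less[OF CA c(1) a(2)])
  ultimately show False by simp
qed

subsection \<open>Splitting sets of indices\<close>

lemma split_card_less:
  fixes W :: "nat set"
  assumes "finite W" "card W = p + q"
  shows "\<exists>K B. K \<union> B = W \<and> card K = p \<and> card B = q \<and> (\<forall>a\<in>K. \<forall>b\<in>B. a < b)"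
  using assms
proof (induction p arbitrary: W)
  case 0
  then show ?case by (intro exI[of _ "{}"] exI[of _ W]) auto
next
  case (Suc p)
  let ?m = "Min W"
  have W: "W \<noteq> {}" using Suc.prems by auto
  then have m: "?m \<in> W" using Suc.prems by simp
  have "card (W - {?m}) = p + q" using Suc.prems m by simp
  with Suc.IH[of "W - {?m}"] Suc.prems(1) obtain K B
    where AB: "K \<union> B = W - {?m}" "card K = p" "card B = q" "\<forall>a\<in>K. \<forall>b\<in>B. a < b"
    by auto
  have "?m < b" if "b \<in> B" for b
  proof -
    have "b \<in> W" "b \<noteq> ?m" using AB(1) that by auto
    then show ?thesis using Min_le[OF Suc.prems(1), of b] by simp
  qed
  moreover have "finite K" "?m \<notin> K" using AB(1) Suc.prems(1) by (auto intro: finite_subset)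
  moreover have "insert ?m K \<union> B = W" using AB(1) m by auto
  ultimately show ?case using AB by (intro exI[of _ "insert ?m K"] exI[of _ B]) auto
qed

lemma split_three_card_less:
  fixes W :: "nat set"
  assumes "finite W" "3 * q \<le> card W"
  obtains K B C where "K \<subseteq> W" "B \<subseteq> W" "C \<subseteq> W" "card K = q" "card B = q" "card C = q"
    "\<And>a b. a \<in> K \<Longrightarrow> b \<in> B \<Longrightarrow> a < b" "\<And>b c. b \<in> B \<Longrightarrow> c \<in> C \<Longrightarrow> b < c"
    "\<And>a c. a \<in> K \<Longrightarrow> c \<in> C \<Longrightarrow> a < c"
proof -
  obtain W' where W': "W' \<subseteq> W" "card W' = 3 * q" "finite W'"
    using obtain_subset_with_card_n[OF assms(2)] by blast
  then have "card W' = q + (q + q)" by simp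
  from split_card_less[OF W'(3) this] obtain K W'' where K: "K \<union> W'' = W'" "card K = q" "card W'' = q + q" "\<forall>a\<in>K. \<forall>b\<in>W''. a < b"
    by (elim exE conjE)
  have "finite W''" using K(1) W'(3) by auto
  from split_card_less[OF this K(3)] obtain B C
    where BC: "B \<union> C = W''" "card B = q" "card C = q" "\<forall>b\<in>B. \<forall>c\<in>C. b < c"
    by (elim exE conjE)
  show ?thesis
  proof (rule that[of K B C])
    show "K \<subseteq> W" "B \<subseteq> W" "C \<subseteq> W" using K(1) BC(1) W'(1) by auto
    show "a < b" if "a \<in> K" "b \<in> B" for a b using K(4) BC(1) that by auto
    show "a < c" if "a \<in> K" "c \<in> C" for a c using K(4) BC(1) that by auto
    show "b < c" if "b \<in> B" "c \<in> C" for b c using BC(4) that by auto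
  qed (use K(2) BC(2,3) in auto)
qed

subsection \<open>Girth and dichromatic number\<close>

lemma cas_append_Cons:
  "pre_digraph.cas G u (p @ e # q) v \<Longrightarrow>
    pre_digraph.cas G u p (tail G e) \<and> pre_digraph.cas G (head G e) q v"
  by (induction p arbitrary: u) (auto simp: pre_digraph.cas.simps)

lemma cas_end_in_heads:
  "pre_digraph.cas G u p v \<Longrightarrow> p \<noteq> [] \<Longrightarrow> v \<in> head G ` set p"
proof (induction p arbitrary: u)
  case (Cons e p)
  then show ?case by (cases p) (auto simp: pre_digraph.cas.simps)
qed simp

lemma cas_awalk_verts:
  "pre_digraph.cas G u p v \<Longrightarrow> pre_digraph.awalk_verts G u p = u # map (head G) p"
  by (induction p arbitrary: u) (auto simp: pre_digraph.cas.simps pre_digraph.awalk_verts.simps)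

lemma cas_relpow:
  "pre_digraph.cas (with_proj G) u p v \<Longrightarrow> set p \<subseteq> Q \<Longrightarrow> (u, v) \<in> Q ^^ length p"
proof (induction p arbitrary: u)
  case (Cons e p)
  then have "(u, snd e) \<in> Q" "(snd e, v) \<in> Q ^^ length p" by (auto simp: pre_digraph.cas.simps)
  then show ?case using relpow_Suc_I2 by (metis length_Cons)
qed (simp add: pre_digraph.cas.simps)

text \<open>Without its first edge \<open>uw\<close>, a cycle is a walk from \<open>w\<close> back
  to \<open>u\<close>. Distinctness of vertices excludes a second use of \<open>(u, w)\<close>, and
  a use of \<open>(w, u)\<close> would force the length 2.\<close>

lemma less_girth_if_no_short_cycle:
  assumes "no_short_cycle l (parcs D \<union> (parcs D)\<inverse>)"
  shows "enat l < girth D"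
proof -
  let ?R = "parcs D \<union> (parcs D)\<inverse>"
  let ?G = "with_proj (mk_symmetric (with_proj D))"
  have R: "parcs (mk_symmetric (with_proj D)) = ?R"
    by (auto simp: parcs_mk_symmetric)
  have "l < length p" if p: "pre_digraph.cycle ?G p" "3 \<le> length p" for p
  proof (rule ccontr)
    assume short: "\<not> l < length p"
    obtain u where aw: "pre_digraph.awalk ?G u p u" and dist: "distinct (tl (pre_digraph.awalk_verts ?G u p))"
      using p(1) unfolding pre_digraph.cycle_def by auto
    obtain e q where eq: "p = e # q" using p(2) by (cases p) auto
    obtain w where e: "e = (u, w)" using aw unfolding eq
      by (cases e) (auto simp: pre_digraph.awalk_def pre_digraph.cas.simps)
    have uw: "(u, w) \<in> ?R" and qR: "set q \<subseteq> ?R" and cq: "pre_digraph.cas ?G w q u"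
      using aw unfolding eq e by (auto simp: pre_digraph.awalk_def pre_digraph.cas.simps R)
    have dq: "distinct (w # map snd q)"
      using dist cas_awalk_verts[OF cq] unfolding eq e by (simp add: pre_digraph.awalk_verts.simps)
    have "(u, w) \<notin> set q" using dq by force
    moreover have "(w, u) \<notin> set q"
    proof
      assume "(w, u) \<in> set q"
      then obtain q1 q2 where q: "q = q1 @ (w, u) # q2" by (meson split_list)
      have "pre_digraph.cas ?G w q1 w" "pre_digraph.cas ?G u q2 u"
        using cas_append_Cons[OF cq[unfolded q]] by auto
      then have "q1 = []" "q2 = []"
        using cas_end_in_heads[of ?G w q1 w] cas_end_in_heads[of ?G u q2 u] dq unfolding q by auto
      then show False using p(2) unfolding eq q by simp
    qed
    ultimately have "set q \<subseteq> ?R - {(w, u), (u, w)}" using qR by auto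
    from cas_relpow[OF cq this] have "(w, u) \<in> (?R - {(w, u), (u, w)}) ^^ length q" .
    moreover have "(w, u) \<in> ?R" "length q < l" using uw short unfolding eq by auto
    ultimately show False using assms unfolding no_short_cycle_def by blast
  qed
  \<comment> \<open>An infimum preserves only non-strict bounds, so the strict one goes through
    \<open>Suc l\<close>.\<close>
  then have "enat (Suc l) \<le> girth D"
    unfolding girth_def by (intro Inf_greatest) (auto simp: Suc_le_eq)
  then show ?thesis by (meson enat_ord_simps(2) less_le_trans lessI)
qed

text \<open>Sets may overlap, be empty or leave \<open>V\<close>, unlike the blocks of a partition.
  Preimages of a cover are therefore again a cover, without any cleaning up.\<close>

definition acyclic_cover :: "('a \<times> 'a) set \<Rightarrow> 'a set \<Rightarrow> nat \<Rightarrow> bool" where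
  "acyclic_cover r V k \<longleftrightarrow>
    (\<exists>P. finite P \<and> card P \<le> k \<and> V \<subseteq> \<Union>P \<and> (\<forall>X\<in>P. acyclic (r \<inter> X \<times> X)))"

text \<open>A cycle of the relation is a nonempty closed walk, and every such walk contains a
  cycle.\<close>

lemma acyclic_if_acyclic_digraph:
  assumes "acyclic_digraph (with_proj D \<restriction> X)"
  shows "acyclic (parcs D \<inter> X \<times> X)"
proof (rule ccontr)
  let ?G = "with_proj D \<restriction> X"
  interpret wf_digraph ?G by unfold_locales (auto simp: induce_subgraph_def)
  have walk: "\<exists>p. p \<noteq> [] \<and> awalk x p y" if "(x, y) \<in> (parcs D \<inter> X \<times> X)\<^sup>+" for x y
    using that
  proof (induction rule: trancl_induct)
    case (base y)
    then have "awalk x [(x, y)] y"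
      unfolding awalk_def cas.simps by (auto simp: induce_subgraph_def)
    then show ?case by blast
  next
    case (step y z)
    then obtain p where p: "awalk x p y" by auto
    have "awalk y [(y, z)] z"
      using step(2) unfolding awalk_def cas.simps by (auto simp: induce_subgraph_def)
    with p have "awalk x (p @ [(y, z)]) z" by (rule awalk_appendI)
    then show ?case by blast
  qed
  assume "\<not> acyclic (parcs D \<inter> X \<times> X)"
  then obtain x where "(x, x) \<in> (parcs D \<inter> X \<times> X)\<^sup>+" unfolding acyclic_def by auto
  then obtain p where "closed_w p" using walk unfolding closed_w_def by blast
  then show False using closed_w_imp_cycle assms unfolding acyclic_digraph_def by blast
qed

lemma less_dichromatic_number_if_not_acyclic_cover:
  assumes fin: "finite (pverts D)" and irrefl: "\<And>x. (x, x) \<notin> parcs D"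
    and not_cover: "\<not> acyclic_cover (parcs D) (pverts D) k"
  shows "k < dichromatic_number D"
proof -
  let ?Q = "\<lambda>k. \<exists>P. partition_on (pverts D) P \<and> finite P \<and> card P = k \<and>
     (\<forall>X\<in>P. acyclic_digraph (with_proj D \<restriction> X))"
  \<comment> \<open>Since there are no loops, the singletons form an admissible partition, so the
    \<open>LEAST\<close> in \<open>dichromatic_number\<close> is attained.\<close>
  let ?S = "(\<lambda>x. {x}) ` pverts D"
  have "partition_on (pverts D) ?S"
    by (auto simp: partition_on_def disjoint_def)
  moreover have "acyclic_digraph (with_proj D \<restriction> {x})" for x
  proof -
    have "arcs (with_proj D \<restriction> {x}) = {}" using irrefl by (auto simp: induce_subgraph_def)
    then show ?thesis
      unfolding acyclic_digraph_def pre_digraph.cycle_def pre_digraph.awalk_def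
      by (simp only: subset_empty set_empty) blast
  qed
  ultimately have "?Q (card ?S)" using fin by (intro exI[of _ ?S]) auto
  then have "?Q (dichromatic_number D)" unfolding dichromatic_number_def by (rule LeastI)
  then obtain P where P: "partition_on (pverts D) P" "finite P" "card P = dichromatic_number D"
    "\<And>X. X \<in> P \<Longrightarrow> acyclic (parcs D \<inter> X \<times> X)"
    using acyclic_if_acyclic_digraph by blast
  show ?thesis
  proof (rule ccontr)
    assume "\<not> ?thesis"
    then have "acyclic_cover (parcs D) (pverts D) k"
      unfolding acyclic_cover_def using P by (intro exI[of _ P]) (auto simp: partition_on_def)
    then show False using not_cover by simp
  qed
qed

subsection \<open>The tournaments A n\<close>

lemma A_Suc_mono:
  assumes V: "pverts (A m) \<subseteq> pverts (A n)" and E: "parcs (A m) \<subseteq> parcs (A n)" and "m \<le> n"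
  shows "pverts (A (Suc m)) \<subseteq> pverts (A (Suc n))" "parcs (A (Suc m)) \<subseteq> parcs (A (Suc n))"
proof -
  have le: "j \<le> Suc m \<Longrightarrow> j \<le> Suc n" for j using assms(3) by simp
  show "pverts (A (Suc m)) \<subseteq> pverts (A (Suc n))"
    unfolding A.simps(2) Let_def pair_pre_digraph.select_convs
    by (intro Un_mono Collect_mono; use V le in blast)
  show "parcs (A (Suc m)) \<subseteq> parcs (A (Suc n))"
    unfolding A.simps(2) Let_def pair_pre_digraph.select_convs
    by (intro Un_mono Collect_mono; use V E le in blast)
qed

text \<open>The inclusion keeps all vertex names: it uses the first indices at every level of the
  recursion, not one of the copies of \<open>A n\<close>. Hence a digraph found in one tournament
  lies unchanged in all later ones.\<close>

lemma A_mono_Suc: "pverts (A n) \<subseteq> pverts (A (Suc n)) \<and> parcs (A n) \<subseteq> parcs (A (Suc n))"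
proof (induction n)
  case (Suc n)
  then show ?case using A_Suc_mono[of n "Suc n"] by (metis le_SucI order_refl)
qed (auto simp: Let_def)

lemma A_mono:
  assumes "m \<le> n"
  shows "pverts (A m) \<subseteq> pverts (A n)" "parcs (A m) \<subseteq> parcs (A n)"
  using lift_Suc_mono_le[of "\<lambda>n. pverts (A n)"] lift_Suc_mono_le[of "\<lambda>n. parcs (A n)"]
    A_mono_Suc assms by blast+

lemma acyclic_if_hom:
  assumes "acyclic s" "\<And>x y. (x, y) \<in> r \<Longrightarrow> (g x, g y) \<in> s"
  shows "acyclic r"
proof -
  have "(g x, g y) \<in> s\<^sup>+" if "(x, y) \<in> r\<^sup>+" for x y
    using that by (induction rule: trancl_induct) (auto intro: assms(2) trancl_into_trancl)
  then show ?thesis using assms(1) unfolding acyclic_def by blast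
qed

text \<open>No arc of \<open>R\<close> leaves its copy, so a walk projects to \<open>rs\<close>, and
  deleting an edge of copy \<open>j\<close> becomes deleting \<open>ab\<close>.\<close>

lemma relpow_copies:
  fixes rs :: "(vtx \<times> vtx) set" and J :: "nat set"
  defines "R \<equiv> {(Copy j x, Copy j y) | j x y. j \<in> J \<and> (x, y) \<in> rs}"
  assumes "(Copy j x, z) \<in> (R - {(Copy j a, Copy j b), (Copy j b, Copy j a)}) ^^ i"
  shows "\<exists>y. z = Copy j y \<and> (x, y) \<in> (rs - {(a, b), (b, a)}) ^^ i"
  using assms(2)
proof (induction i arbitrary: z)
  case (Suc i)
  then obtain z' where z': "(Copy j x, z') \<in> (R - {(Copy j a, Copy j b), (Copy j b, Copy j a)}) ^^ i"
    "(z', z) \<in> R - {(Copy j a, Copy j b), (Copy j b, Copy j a)}" by auto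
  then obtain y' where "z' = Copy j y'" "(x, y') \<in> (rs - {(a, b), (b, a)}) ^^ i"
    using Suc.IH by blast
  moreover then obtain y where "z = Copy j y" "(y', y) \<in> rs - {(a, b), (b, a)}"
    using z'(2) unfolding R_def by auto
  ultimately show ?case by auto
qed simp

lemma no_short_cycle_copies:
  assumes "no_short_cycle l rs"
  shows "no_short_cycle l {(Copy j x, Copy j y) | j x y. j \<in> J \<and> (x, y) \<in> rs}"
  unfolding no_short_cycle_def
proof (intro allI impI notI)
  fix u v i
  let ?R = "{(Copy j x, Copy j y) | j x y. j \<in> J \<and> (x, y) \<in> rs}"
  assume "(u, v) \<in> ?R" and i: "i < l" and w: "(u, v) \<in> (?R - {(u, v), (v, u)}) ^^ i"
  then obtain j x y where uv: "u = Copy j x" "v = Copy j y" "(x, y) \<in> rs" by blast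
  have "(x, y) \<in> (rs - {(x, y), (y, x)}) ^^ i"
    using relpow_copies[OF w[unfolded uv(1,2)]] by auto
  then show False using assms i uv(3) unfolding no_short_cycle_def by blast
qed

subsection \<open>The induction on the number of colours\<close>

lemma acyclic_cover_of_copy_meets:
  assumes P: "finite P" "card P \<le> Suc k" "\<And>X. X \<in> P \<Longrightarrow> acyclic (s \<inter> X \<times> X)"
    and X: "X \<in> P" "g ` V \<inter> X = {}" and cov: "g ` V \<subseteq> \<Union>P"
    and hom: "\<And>x y. (x, y) \<in> r \<Longrightarrow> (g x, g y) \<in> s"
  shows "acyclic_cover r V k"
  unfolding acyclic_cover_def
proof (intro exI[of _ "(\<lambda>Y. g -` Y) ` (P - {X})"] conjI ballI)
  have "card (P - {X}) \<le> k" using P(1,2) X(1) by (simp add: card_Diff_singleton)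
  then show "card ((\<lambda>Y. g -` Y) ` (P - {X})) \<le> k"
    using P(1) card_image_le[of "P - {X}" "\<lambda>Y. g -` Y"] by simp
  show "V \<subseteq> \<Union> ((\<lambda>Y. g -` Y) ` (P - {X}))"
  proof
    fix x assume "x \<in> V"
    then obtain Y where "Y \<in> P" "g x \<in> Y" using cov by blast
    moreover have "Y \<noteq> X" using X(2) \<open>x \<in> V\<close> \<open>g x \<in> Y\<close> by blast
    ultimately show "x \<in> \<Union> ((\<lambda>Y. g -` Y) ` (P - {X}))" by blast
  qed
  fix Z assume "Z \<in> (\<lambda>Y. g -` Y) ` (P - {X})"
  then obtain Y where "Y \<in> P" "Z = g -` Y" by blast
  then show "acyclic (r \<inter> Z \<times> Z)"
    using hom by (intro acyclic_if_hom[OF P(3)[of Y], where g = g]) auto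
qed (use P(1) in simp)

lemma ex_large_part:
  assumes P: "finite P" "card P \<le> Suc k" and cov: "I \<subseteq> \<Union>P" and "I \<noteq> {}"
  shows "\<exists>X\<in>P. card I \<le> Suc k * card (I \<inter> X)"
proof (rule ccontr)
  assume "\<not> ?thesis"
  then have less: "Suc k * card (I \<inter> X) < card I" if "X \<in> P" for X
    using that by (auto simp: not_le)
  have "P \<noteq> {}" using \<open>I \<noteq> {}\<close> cov by auto
  have "I = (\<Union>X\<in>P. I \<inter> X)" using cov by auto
  then have "card I \<le> (\<Sum>X\<in>P. card (I \<inter> X))" using card_UN_le[OF P(1), of "\<lambda>X. I \<inter> X"] by simp
  then have "Suc k * card I \<le> (\<Sum>X\<in>P. Suc k * card (I \<inter> X))"
    by (metis mult_le_mono2 sum_distrib_left)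
  also have "\<dots> < (\<Sum>X\<in>P. card I)" using less P(1) \<open>P \<noteq> {}\<close> by (intro sum_strict_mono) auto
  also have "\<dots> \<le> Suc k * card I" using P(2) by (simp add: mult_le_mono1 del: mult_Suc)
  finally show False by simp
qed

lemma not_acyclic_cover_step:
  fixes r :: "(vtx \<times> vtx) set"
  assumes V: "finite V" "V \<subseteq> pverts (A f)" and r: "r \<subseteq> parcs (A f)" "r \<subseteq> V \<times> V"
    and cyc: "no_short_cycle l (r \<union> r\<inverse>)" and nc: "\<not> acyclic_cover r V k"
  shows "\<exists>m V' r'. V' \<subseteq> pverts (A m) \<and> r' \<subseteq> parcs (A m) \<and> r' \<subseteq> V' \<times> V' \<and>
    no_short_cycle l (r' \<union> r'\<inverse>) \<and> \<not> acyclic_cover r' V' (Suc k)"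
proof -
  define h where "h = card V"
  \<comment> \<open>The new vertex set will have at most \<open>n * (h + 2)\<close> elements, and
    the sets to be joined at least \<open>n / (12 * Suc k)\<close>.\<close>
  define \<epsilon> :: real where "\<epsilon> = 1 / (12 * Suc k * (h + 2))"
  have "1 \<le> 12 * Suc k * (h + 2)" by simp
  then have "1 \<le> real (12 * Suc k * (h + 2))" by linarith
  then have \<epsilon>: "0 < \<epsilon>" "\<epsilon> \<le> 1" unfolding \<epsilon>_def by (auto simp: divide_le_eq simp del: of_nat_mult)
  let ?rs = "r \<union> r\<inverse>"
  show ?thesis
  \<comment> \<open>Disjoint copies have degrees at most \<open>card ?rs\<close> however many there
    are, so \<open>N\<close> can be fixed before \<open>n\<close>.\<close>
  proof (rule sparse_hitting_arcs[OF \<epsilon>, of l "card ?rs"])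
    fix N
    assume N: "\<And>V (R :: (vtx \<times> vtx) set) E. finite V \<Longrightarrow> N \<le> card V \<Longrightarrow> R \<subseteq> V \<times> V \<Longrightarrow> sym R \<Longrightarrow>
      no_short_cycle l R \<Longrightarrow> (\<And>u. card (R `` {u}) \<le> card ?rs) \<Longrightarrow>
      \<exists>S. S \<subseteq> E \<and> S \<subseteq> V \<times> V \<and> no_short_cycle l (R \<union> S \<union> S\<inverse>) \<and> hits_large_products \<epsilon> V E S"
    \<comment> \<open>The summand \<open>f\<close> places the given digraph inside
      \<open>A m\<close>, \<open>N\<close> makes \<open>V'\<close> large enough, and
      \<open>4 * Suc k\<close> absorbs the rounding in the division by three below.\<close>
    define m where "m = f + N + 4 * Suc k"
    define n where "n = Suc m"
    have Vm: "V \<subseteq> pverts (A m)" "r \<subseteq> parcs (A m)"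
      using A_mono[of f m] V(2) r(1) unfolding m_def by auto
    define V' where "V' = New ` {..n} \<union> (\<lambda>(j, x). Copy j x) ` ({1..n} \<times> V)"
    define cp where "cp = (\<lambda>rs. {(Copy j x, Copy j y) | j x y. j \<in> {1..n} \<and> (x, y) \<in> rs})"
    have copyV': "Copy j x \<in> V'" if "j \<in> {1..n}" "x \<in> V" for j x
      using that imageI[of "(j, x)" "{1..n} \<times> V" "\<lambda>(j, x). Copy j x"] unfolding V'_def by simp
    have fV': "finite V'" unfolding V'_def using V(1) by simp
    have "card V' \<le> card (New ` {..n}) + card ((\<lambda>(j, x). Copy j x) ` ({1..n} \<times> V))"
      unfolding V'_def by (rule card_Un_le)
    also have "\<dots> \<le> Suc n + n * h"
      using card_image_le[of "{..n}" New] card_image_le[of "{1..n} \<times> V" "\<lambda>(j, x). Copy j x"] V(1)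
      unfolding h_def by (intro add_mono) (auto simp: card_cartesian_product)
    also have "\<dots> \<le> n * (h + 2)" unfolding n_def by simp
    finally have cV': "card V' \<le> n * (h + 2)" .
    have "Suc n = card (New ` {..n})" by (subst card_image) (auto simp: inj_on_def)
    also have "\<dots> \<le> card V'" using fV' by (intro card_mono) (auto simp: V'_def)
    finally have NV': "N \<le> card V'" unfolding n_def m_def by simp
    have cpV': "cp ?rs \<subseteq> V' \<times> V'" unfolding cp_def V'_def using r(2) by auto
    have symcp: "sym (cp ?rs)" unfolding cp_def sym_def by auto
    have fr: "finite ?rs" using r(2) V(1) by (metis finite_SigmaI finite_Un finite_converse finite_subset)
    have deg: "card (cp ?rs `` {u}) \<le> card ?rs" for u
    proof (cases u)
      case (New i)
      then have "cp ?rs `` {u} = {}" unfolding cp_def by auto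
      then show ?thesis by simp
    next
      case (Copy j x)
      have "cp ?rs `` {u} \<subseteq> (\<lambda>e. Copy j (snd e)) ` ?rs" unfolding cp_def Copy by force
      then show ?thesis by (rule surj_card_le[OF fr])
    qed
    have "no_short_cycle l (cp ?rs)"
      unfolding cp_def by (rule no_short_cycle_copies[OF cyc])
    from N[OF fV' NV' cpV' symcp this deg, of "parcs (A n)"]
    obtain S where S: "S \<subseteq> parcs (A n)" "S \<subseteq> V' \<times> V'" "no_short_cycle l (cp ?rs \<union> S \<union> S\<inverse>)"
      and hits: "hits_large_products \<epsilon> V' (parcs (A n)) S"
      by (elim exE conjE)
    define r' where "r' = cp r \<union> S"
    have "r' \<union> r'\<inverse> = cp ?rs \<union> S \<union> S\<inverse>" unfolding r'_def cp_def by auto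
    then have cyc': "no_short_cycle l (r' \<union> r'\<inverse>)" using S(3) by simp
    have "cp r \<subseteq> parcs (A n)" unfolding cp_def n_def using Vm(2) by (auto simp: Let_def)
    then have r'A: "r' \<subseteq> parcs (A n)" using S(1) unfolding r'_def by simp
    have "cp r \<subseteq> cp ?rs" unfolding cp_def by auto
    then have r'V': "r' \<subseteq> V' \<times> V'" using S(2) cpV' unfolding r'_def by blast
    have V'A: "V' \<subseteq> pverts (A n)" unfolding V'_def n_def using Vm(1) by (auto simp: Let_def)
    have "\<not> acyclic_cover r' V' (Suc k)"
    proof
      assume "acyclic_cover r' V' (Suc k)"
      then obtain P where P: "finite P" "card P \<le> Suc k" "V' \<subseteq> \<Union>P"
        "\<And>X. X \<in> P \<Longrightarrow> acyclic (r' \<inter> X \<times> X)"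
        unfolding acyclic_cover_def by blast
      have "\<exists>X\<in>P. card (New ` {..n}) \<le> Suc k * card (New ` {..n} \<inter> X)"
        using P(1-3) unfolding V'_def by (intro ex_large_part) auto
      then obtain X where X: "X \<in> P" "card (New ` {..n}) \<le> Suc k * card (New ` {..n} \<inter> X)" by blast
      define W where "W = {i. i \<le> n \<and> New i \<in> X}"
      have "New ` {..n} \<inter> X = New ` W" unfolding W_def by auto
      then have cW: "Suc n \<le> Suc k * card W"
        using X(2) by (simp add: card_image inj_on_def)
      have fW: "finite W" unfolding W_def by simp
      define q where "q = card W div 3"
      have "card W \<le> 3 * q + 2" unfolding q_def by linarith
      then have "Suc k * card W \<le> Suc k * (3 * q + 2)" by (rule mult_le_mono2)
      \<comment> \<open>The rounding term \<open>2 * Suc k\<close> is at most \<open>n / 2\<close>,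
        so the other term is at least \<open>n / 2\<close>.\<close>
      then have "Suc n \<le> 3 * (Suc k * q) + 2 * Suc k" using cW by (simp add: algebra_simps)
      moreover have "4 * Suc k \<le> n" unfolding n_def m_def by simp
      ultimately have q: "n \<le> 6 * (Suc k * q)" by linarith
      then have q0: "q > 0" unfolding n_def by (metis gr0I less_Suc_eq_0_disj mult_0_right not_less)
      \<comment> \<open>Half of a set of size \<open>q\<close> still counts as large for
        \<open>hits_large_products\<close>.\<close>
      have large: "\<epsilon> * card V' \<le> card Z" if "q \<le> 2 * card Z" for Z :: "vtx set"
      proof -
        have "n \<le> 12 * (Suc k * card Z)"
          using q mult_le_mono2[OF that, of "6 * Suc k"] by (simp add: algebra_simps)
        then have "n * (h + 2) \<le> 12 * (Suc k * card Z) * (h + 2)" by (rule mult_le_mono1)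
        then have "card V' \<le> 12 * (Suc k * card Z) * (h + 2)" using cV' by linarith
        then have "card V' \<le> card Z * (12 * Suc k * (h + 2))" by (simp only: ac_simps)
        then have "real (card V') \<le> real (card Z) * real (12 * Suc k * (h + 2))"
          by (metis of_nat_le_iff of_nat_mult)
        moreover have "0 < real (12 * Suc k * (h + 2))" by (simp only: of_nat_0_less_iff) simp
        ultimately show ?thesis unfolding \<epsilon>_def
          by (simp only: times_divide_eq_left mult_1 pos_divide_le_eq)
      qed
      have "\<exists>x\<in>V. Copy j x \<in> X" if "j \<in> {1..n}" for j
      proof (rule ccontr)
        assume "\<not> ?thesis"
        then have "Copy j ` V \<inter> X = {}" by auto
        moreover have "Copy j ` V \<subseteq> \<Union>P" using copyV'[OF that] P(3) by (intro image_subsetI) blast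
        moreover have "\<And>x y. (x, y) \<in> r \<Longrightarrow> (Copy j x, Copy j y) \<in> r'"
          using that unfolding r'_def cp_def by blast
        ultimately have "acyclic_cover r V k"
          by (intro acyclic_cover_of_copy_meets[OF P(1,2,4) X(1)])
        then show False using nc by simp
      qed
      then obtain x where x: "\<And>j. j \<in> {1..n} \<Longrightarrow> x j \<in> V \<and> Copy j (x j) \<in> X" by metis
      have "3 * q \<le> card W" unfolding q_def by simp
      from split_three_card_less[OF fW this] obtain K M L
        where W: "K \<subseteq> W" "M \<subseteq> W" "L \<subseteq> W" and c: "card K = q" "card M = q" "card L = q"
          and less: "\<And>a b. a \<in> K \<Longrightarrow> b \<in> M \<Longrightarrow> a < b" "\<And>b c. b \<in> M \<Longrightarrow> c \<in> L \<Longrightarrow> b < c"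
            "\<And>a c. a \<in> K \<Longrightarrow> c \<in> L \<Longrightarrow> a < c"
        by blast
      have fin: "finite K" "finite M" "finite L" using W fW finite_subset by blast+
      have "K \<noteq> {}" using c q0 by auto
      \<comment> \<open>Copies are numbered from 1 while \<open>W\<close> may contain 0. Each
        element of \<open>M\<close> exceeds one of \<open>K\<close> and so is not 0.\<close>
      then have M: "M \<subseteq> {1..n}" using less(1) W(2) unfolding W_def by fastforce
      let ?g = "\<lambda>i. Copy i (x i)"
      have cK: "card (New ` K) = q" and cL: "card (New ` L) = q" and cM: "card (?g ` M) = q"
        using c by (simp_all add: card_image inj_on_def)
      have sub: "New ` K \<subseteq> V' \<inter> X" "New ` L \<subseteq> V' \<inter> X"
        using W unfolding W_def V'_def by auto
      have sub_M: "?g ` M \<subseteq> V' \<inter> X"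
      proof (rule image_subsetI)
        fix i assume "i \<in> M"
        then have i: "i \<in> {1..n}" using M by blast
        then show "?g i \<in> V' \<inter> X" using x[OF i] copyV'[OF i] by simp
      qed
      have arcs: "New ` K \<times> ?g ` M \<subseteq> parcs (A n)" "?g ` M \<times> New ` L \<subseteq> parcs (A n)"
        "New ` L \<times> New ` K \<subseteq> parcs (A n)"
      proof -
        have "(New a, ?g b) \<in> parcs (A n)" if "a \<in> K" "b \<in> M" for a b
        proof -
          have "b \<in> {1..n}" using M that by auto
          then show ?thesis using less(1)[OF that] x[of b] Vm(1) unfolding n_def by (auto simp: Let_def)
        qed
        then show "New ` K \<times> ?g ` M \<subseteq> parcs (A n)" by auto
        have "(?g b, New c) \<in> parcs (A n)" if "b \<in> M" "c \<in> L" for b c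
        proof -
          have "b \<in> {1..n}" using M that by auto
          moreover have "c \<le> n" using W(3) that(2) unfolding W_def by auto
          ultimately show ?thesis using less(2)[OF that] x[of b] Vm(1) unfolding n_def by (auto simp: Let_def)
        qed
        then show "?g ` M \<times> New ` L \<subseteq> parcs (A n)" by auto
        have "(New c, New a) \<in> parcs (A n)" if "a \<in> K" "c \<in> L" for a c
        proof -
          have "c \<le> n" using W(3) that(2) unfolding W_def by auto
          then show ?thesis using less(3)[OF that] unfolding n_def by (auto simp: Let_def)
        qed
        then show "New ` L \<times> New ` K \<subseteq> parcs (A n)" by auto
      qed
      have hit: "(r' \<inter> X \<times> X) \<inter> Y \<times> Z \<noteq> {}"
        if "Y' \<times> Z' \<subseteq> parcs (A n)" "Y' \<subseteq> V' \<inter> X" "Z' \<subseteq> V' \<inter> X" "card Y' = q" "card Z' = q"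
          "Y \<subseteq> Y'" "Z \<subseteq> Z'" "card Y' \<le> 2 * card Y" "card Z' \<le> 2 * card Z" for Y Z Y' Z'
      proof -
        have "Y \<times> Z \<subseteq> parcs (A n)" using that(1,6,7) by blast
        moreover have "Y \<subseteq> V'" "Z \<subseteq> V'" using that(2,3,6,7) by blast+
        ultimately have "S \<inter> Y \<times> Z \<noteq> {}"
          using large[of Y] large[of Z] that(4,5,8,9) hits unfolding hits_large_products_def by simp
        then show ?thesis using that(2,3,6,7) unfolding r'_def by blast
      qed
      have "\<not> acyclic (r' \<inter> X \<times> X)"
      proof (rule not_acyclic_if_dense_triple)
        have "finite r'" using r'V' fV' by (meson finite_SigmaI finite_subset)
        then show "finite (r' \<inter> X \<times> X)" by simp
        show "finite (New ` K)" "finite (?g ` M)" "finite (New ` L)" using fin by auto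
        show "New ` K \<noteq> {}" "?g ` M \<noteq> {}" "New ` L \<noteq> {}" using c q0 by auto
      qed (fact hit[OF arcs(1) sub(1) sub_M cK cM] hit[OF arcs(2) sub_M sub(2) cM cL]
          hit[OF arcs(3) sub(2,1) cL cK])+
      then show False using P(4) X(1) by blast
    qed
    then show ?thesis using V'A r'A r'V' cyc' by blast
  qed
qed

lemma ex_not_acyclic_cover:
  "\<exists>f V r. V \<subseteq> pverts (A f) \<and> r \<subseteq> parcs (A f) \<and> r \<subseteq> V \<times> V \<and>
    no_short_cycle l (r \<union> r\<inverse>) \<and> \<not> acyclic_cover r V k"
proof (induction k)
  case 0
  \<comment> \<open>A single vertex is not covered by the empty family.\<close>
  show ?case
    by (intro exI[of _ 0] exI[of _ "{New 0}"] exI[of _ "{}"]) (auto simp: no_short_cycle_def acyclic_cover_def)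
next
  case (Suc k)
  then obtain f V r where V: "V \<subseteq> pverts (A f)" and "r \<subseteq> parcs (A f)" "r \<subseteq> V \<times> V"
    "no_short_cycle l (r \<union> r\<inverse>)" "\<not> acyclic_cover r V k" by blast
  moreover have "finite V" using V A_wf finite_subset by blast
  ultimately show ?case using not_acyclic_cover_step by presburger
qed

theorem proposition11:
  fixes k l :: nat
  assumes "l \<ge> 3"
  shows "\<exists>f. \<exists>S. subgraph (with_proj S) (with_proj (A f)) \<and>
           dichromatic_number S > k \<and> girth S > enat l"
proof -
  from ex_not_acyclic_cover[of l k]
  obtain f V r where V: "V \<subseteq> pverts (A f)" and r: "r \<subseteq> parcs (A f)" "r \<subseteq> V \<times> V"
    and cyc: "no_short_cycle l (r \<union> r\<inverse>)" and nc: "\<not> acyclic_cover r V k"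
    by (elim exE conjE)
  let ?S = "\<lparr> pverts = V, parcs = r \<rparr>"
  have "wf_digraph (with_proj (A f))" "wf_digraph (with_proj ?S)"
    using A_wf[of f] r(2) by (unfold_locales; auto)+
  then have "subgraph (with_proj ?S) (with_proj (A f))"
    using V r(1) by (auto simp: subgraph_def compatible_def)
  moreover have "finite V" using V A_wf finite_subset by blast
  then have "k < dichromatic_number ?S"
    using r(1) A_irrefl nc by (intro less_dichromatic_number_if_not_acyclic_cover) auto
  moreover have "enat l < girth ?S" using cyc by (intro less_girth_if_no_short_cycle) simp
  ultimately show ?thesis by blast
qed

end
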